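(* Let $d\ge1$, $\epsilon>0$ and $L>0$ be fixed. (i) For each $D>d$ let $x^*,p\in\mathbb{R}^D$ with $\|x^*-p\|>\epsilon/L$, where $\|x^*-p\|$ is either fixed or tends to infinity as $D\to\infty$, and let $r_p:=\epsilon/(L\|x^*-p\|)$. Then $$\tau(r_p,d,D)=\Theta\left(D^{\frac{d-2}{2}}\left(\frac{\epsilon}{L\|x^*-p\|}\right)^{D-d}\right)\quad\text{as } D\to\infty,$$ where the constants in $\Theta(\cdot)$ are independent of $D$. (ii) Similarly, for $R_{\max}>\epsilon/L$ either fixed or tending to infinity as $D\to\infty$, and $r_{\min}:=\epsilon/(LR_{\max})$, $$\tau(r_{\min},d,D)=\Theta\left(D^{\frac{d-2}{2}}\left(\frac{\epsilon}{LR_{\max}}\right)^{D-d}\right)\quad\text{as } D\to\infty.$$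
   Context: For $0<r<1$ and integers $1\le d<D$, $$\tau(r,d,D):=\begin{cases}(D-1)\binom{\frac{D-2}{2}}{\frac{D-1}{2}}\displaystyle\int_0^{\arcsin(r)}\sin^{D-2}(x)\,dx & \text{if } d=1,\\[2mm] \binom{\frac{D-2}{2}}{\frac{D-d}{2}}\,r^{D-d}(1-r^2)^{\frac{d-2}{2}} & \text{if } 1<d<D,\end{cases}$$ where $\binom{i}{j}=\frac{\Gamma(i+1)}{\Gamma(j+1)\Gamma(i-j+1)}$ for real $i,j$. The notation $u(D)=\Theta(g(D))$ as $D\to\infty$ (with $g>0$) means that there exist $M_1,M_2>0$ and $D_0$ such that $M_1g(D)\le|u(D)|\le M_2g(D)$ for all $D\ge D_0$. $\|\cdot\|$ is the Euclidean norm. *)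

theory Defs
  imports "HOL-Analysis.Analysis" "HOL-Library.Landau_Symbols"
begin

definition gamma_binomial :: "real \<Rightarrow> real \<Rightarrow> real" where
  "gamma_binomial i j = Gamma (i + 1) / (Gamma (j + 1) * Gamma (i - j + 1))"

(* Meant for 0 < r < 1 and 1 \<le> d < D; the natural-number subtractions D - 2 and
   D - d in the exponents are then exact and 1 - r^2 is a positive base for powr. *)
definition tau :: "real \<Rightarrow> nat \<Rightarrow> nat \<Rightarrow> real" where
  "tau r d D =
     (if d = 1
      then (real D - 1) * gamma_binomial ((real D - 2) / 2) ((real D - 1) / 2)
             * integral {0..arcsin r} (\<lambda>x. sin x ^ (D - 2))
      else gamma_binomial ((real D - 2) / 2) ((real D - real d) / 2)
             * r ^ (D - d) * (1 - r\<^sup>2) powr ((real d - 2) / 2))"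

(* Since D varies, a vector of R^D is encoded as a function on nat of which only the
   coordinates i < D are used. *)
definition euclid_dist :: "nat \<Rightarrow> (nat \<Rightarrow> real) \<Rightarrow> (nat \<Rightarrow> real) \<Rightarrow> real" where
  "euclid_dist D x y = L2_set (\<lambda>i. x i - y i) {..<D}"

definition fixed_or_to_infinity :: "nat \<Rightarrow> (nat \<Rightarrow> real) \<Rightarrow> bool" where
  "fixed_or_to_infinity d R \<longleftrightarrow>
     (\<exists>c. \<forall>D>d. R D = c) \<or> filterlim R at_top at_top"

end

(* The binomial factor of tau is a ratio of Gamma values whose arguments differ by (d - 2)/2 (for
   d = 1 as well), so it is of order D^((d-2)/2): log-convexity of Gamma gives
   Gamma (x + a) / Gamma x = Theta(x^a) for 0 <= a <= 1, and the functional equation extends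
   this to all real a. Since r stays below some q < 1, the remaining factors are harmless:
   (1 - r^2)^((d-2)/2) is bounded away from 0 and infinity, and for d = 1 inserting a factor
   cos x, which lies between sqrt (1 - q^2) and 1, changes the integral of sin^(D-2)
   into r^(D-1) / (D-1). *)
theory Submission
  imports Defs "HOL-Real_Asymp.Real_Asymp"
begin

section \<open>Growth of ratios of Gamma values\<close>

lemma Gamma_plus1_pos_real:
  fixes x :: real
  assumes "x > 0"
  shows "Gamma (x + 1) = x * Gamma x"
proof -
  have "x \<notin> \<int>\<^sub>\<le>\<^sub>0"
    using assms nonpos_Ints_nonpos[of x] by linarith
  then show ?thesis
    by (rule Gamma_plus1)
qed

text \<open>Log-convexity on the segment from x to x + 1, in which x + a has weights 1 - a and a;
  the functional equation removes the value at x + 1.\<close>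

lemma Gamma_add_le:
  fixes x a :: real
  assumes "x > 0" "0 \<le> a" "a \<le> 1"
  shows "Gamma (x + a) \<le> x powr a * Gamma x"
proof -
  have eq: "x + a = (1 - a) *\<^sub>R x + a *\<^sub>R (x + 1)"
    by (simp add: algebra_simps)
  have "ln (Gamma (x + a)) \<le> (1 - a) * ln (Gamma x) + a * ln (Gamma (x + 1))"
    unfolding eq using convex_onD[OF log_convex_Gamma_real, of a x "x + 1"] assms by simp
  also have "ln (Gamma (x + 1)) = ln x + ln (Gamma x)"
    using assms by (simp add: Gamma_plus1_pos_real ln_mult_pos)
  also have "(1 - a) * ln (Gamma x) + a * (ln x + ln (Gamma x)) = ln (x powr a * Gamma x)"
    using assms by (simp add: ln_mult_pos ln_powr algebra_simps)
  finally show ?thesis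
    using assms by (simp add: Gamma_real_pos)
qed

lemma Gamma_ratio_bigtheta_unit:
  fixes a :: real
  assumes "0 \<le> a" "a \<le> 1"
  shows "(\<lambda>x. Gamma (x + a) / Gamma x) \<in> \<Theta>(\<lambda>x. x powr a)"
proof (rule bigthetaI)
  have "eventually (\<lambda>x. norm (Gamma (x + a) / Gamma x) \<le> 1 * norm (x powr a)) at_top"
    using eventually_gt_at_top[of 0]
  proof eventually_elim
    case (elim x)
    have "Gamma x > 0" "Gamma (x + a) > 0"
      using elim assms by auto
    with Gamma_add_le[OF elim assms] show ?case
      by (simp add: pos_divide_le_eq)
  qed
  then show "(\<lambda>x. Gamma (x + a) / Gamma x) \<in> O(\<lambda>x. x powr a)"
    by (rule bigoI)
  \<comment> \<open>For the lower bound, \<open>Gamma_add_le\<close> is applied a second time, from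
    x + a to x + 1 with increment 1 - a. The resulting bound x (x + a)^(a - 1) is of order
    x^a.\<close>
  have "eventually (\<lambda>x. norm (x * (x + a) powr (a - 1)) \<le> 1 * norm (Gamma (x + a) / Gamma x)) at_top"
    using eventually_gt_at_top[of 0]
  proof eventually_elim
    case (elim x)
    have pos: "Gamma x > 0" "Gamma (x + a) > 0" "x + a > 0"
      using elim assms by auto
    have "x * Gamma x = Gamma (x + a + (1 - a))"
      using elim by (simp add: Gamma_plus1_pos_real)
    also have "\<dots> \<le> (x + a) powr (1 - a) * Gamma (x + a)"
      using pos assms by (intro Gamma_add_le) auto
    finally have "(x + a) powr (a - 1) * (x * Gamma x)
        \<le> (x + a) powr (a - 1) * ((x + a) powr (1 - a) * Gamma (x + a))"
      by (rule mult_left_mono) simp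
    also have "\<dots> = Gamma (x + a)"
      using pos by (simp flip: powr_add mult.assoc)
    finally show ?case
      using pos elim by (simp add: pos_le_divide_eq mult_ac)
  qed
  then have "(\<lambda>x. x * (x + a) powr (a - 1)) \<in> O(\<lambda>x. Gamma (x + a) / Gamma x)"
    by (rule bigoI)
  moreover have "(\<lambda>x. x powr a) \<in> O(\<lambda>x. x * (x + a) powr (a - 1))"
    by real_asymp
  ultimately show "(\<lambda>x. Gamma (x + a) / Gamma x) \<in> \<Omega>(\<lambda>x. x powr a)"
    unfolding bigomega_iff_bigo by (blast intro: landau_o.big_trans)
qed

text \<open>By the functional equation the shift multiplies the ratio by x + a and the comparison
  function by x, and these are of the same order. An equivalence is needed because the integer
  induction below runs upwards and downwards.\<close>

lemma Gamma_ratio_bigtheta_shift: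
  fixes a :: real
  shows "(\<lambda>x. Gamma (x + (a + 1)) / Gamma x) \<in> \<Theta>(\<lambda>x. x powr (a + 1)) \<longleftrightarrow>
         (\<lambda>x. Gamma (x + a) / Gamma x) \<in> \<Theta>(\<lambda>x. x powr a)"
proof -
  have ev: "eventually (\<lambda>x::real. x > max 0 (- a)) at_top"
    by (rule eventually_gt_at_top)
  have 1: "eventually (\<lambda>x. Gamma (x + (a + 1)) / Gamma x = (x + a) * (Gamma (x + a) / Gamma x)) at_top"
    using ev
  proof eventually_elim
    case (elim x)
    then show ?case
      using Gamma_plus1_pos_real[of "x + a"] by (simp add: add.assoc)
  qed
  have 2: "eventually (\<lambda>x. x powr (a + 1) = x * x powr a) at_top"
    using ev by eventually_elim (simp add: powr_add)
  have 3: "(\<lambda>x. x + a) \<in> \<Theta>(\<lambda>x. x)"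
    by real_asymp
  have nz: "eventually (\<lambda>x::real. x \<noteq> 0) at_top"
    using ev by eventually_elim auto
  have "(\<lambda>x. Gamma (x + (a + 1)) / Gamma x) \<in> \<Theta>(\<lambda>x. x powr (a + 1)) \<longleftrightarrow>
        (\<lambda>x. (x + a) * (Gamma (x + a) / Gamma x)) \<in> \<Theta>(\<lambda>x. x * x powr a)"
    using landau_theta.in_cong[OF 1] landau_theta.cong[OF 2] by simp
  also have "\<dots> \<longleftrightarrow> (\<lambda>x. x * (Gamma (x + a) / Gamma x)) \<in> \<Theta>(\<lambda>x. x * x powr a)"
    by (rule landau_theta.in_cong_bigtheta[OF landau_theta.mult[OF 3 bigtheta_refl]])
  also have "\<dots> \<longleftrightarrow> (\<lambda>x. Gamma (x + a) / Gamma x) \<in> \<Theta>(\<lambda>x. x powr a)"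
    by (rule landau_theta.mult_cancel_left[OF bigtheta_refl nz])
  finally show ?thesis .
qed

lemma Gamma_ratio_bigtheta:
  fixes a :: real
  shows "(\<lambda>x. Gamma (x + a) / Gamma x) \<in> \<Theta>(\<lambda>x. x powr a)"
proof -
  \<comment> \<open>Induction over the integer part of a: the base case is \<open>frac a\<close>,
    which lies in the unit interval.\<close>
  have "(\<lambda>x. Gamma (x + (frac a + of_int k)) / Gamma x) \<in> \<Theta>(\<lambda>x. x powr (frac a + of_int k))" for k
  proof (induction k rule: int_induct[where k = 0])
    case base
    show ?case
      using Gamma_ratio_bigtheta_unit[of "frac a"] frac_lt_1[of a] by simp
  next
    case (step1 k)
    then show ?case
      using Gamma_ratio_bigtheta_shift[of "frac a + of_int k"] by (simp add: add.assoc)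
  next
    case (step2 k)
    then show ?case
      using Gamma_ratio_bigtheta_shift[of "frac a + of_int (k - 1)"] by (simp add: algebra_simps)
  qed
  from this[of "\<lfloor>a\<rfloor>"] show ?thesis
    by (simp add: frac_def)
qed

section \<open>The binomial and integral factors of \<open>tau\<close>\<close>

text \<open>With a = 1 - d/2 the binomial is Gamma (D/2) / (Gamma (d/2) Gamma (D/2 + a)), so the
  Gamma ratio enters inverted and gives the exponent -a = (d - 2)/2. At d = 1 this is also the
  binomial in the first branch of \<open>tau\<close>.\<close>

lemma gamma_binomial_bigtheta:
  assumes "d \<ge> 1"
  shows "(\<lambda>D. gamma_binomial ((real D - 2) / 2) ((real D - real d) / 2))
           \<in> \<Theta>(\<lambda>D. real D powr ((real d - 2) / 2))"
proof -
  define a where "a = 1 - real d / 2"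
  have lim: "filterlim (\<lambda>D. real D / 2) at_top sequentially"
    by real_asymp
  have G: "(\<lambda>D. Gamma (real D / 2 + a) / Gamma (real D / 2)) \<in> \<Theta>(\<lambda>D. (real D / 2) powr a)"
    using landau_theta.compose[OF Gamma_ratio_bigtheta lim] .
  have "(\<lambda>D. inverse (Gamma (real D / 2 + a) / Gamma (real D / 2))) \<in> \<Theta>(\<lambda>D. inverse ((real D / 2) powr a))"
    using G by (simp only: bigtheta_inverse)
  moreover have "inverse ((real D / 2) powr a) = 2 powr a * real D powr ((real d - 2) / 2)" for D
  proof -
    have "inverse ((real D / 2) powr a) = 2 powr a * real D powr (- a)"
      by (simp add: powr_divide powr_minus divide_simps)
    then show ?thesis
      by (simp add: a_def diff_divide_distrib)
  qed
  moreover have "gamma_binomial ((real D - 2) / 2) ((real D - real d) / 2)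
      = inverse (Gamma (real d / 2)) * inverse (Gamma (real D / 2 + a) / Gamma (real D / 2))" for D
  proof -
    have "(real D - 2) / 2 + 1 = real D / 2" "(real D - real d) / 2 + 1 = real D / 2 + a"
      "(real D - 2) / 2 - (real D - real d) / 2 + 1 = real d / 2"
      by (simp_all add: a_def field_simps)
    then show ?thesis
      unfolding gamma_binomial_def by (simp only: divide_inverse inverse_mult_distrib inverse_inverse_eq mult_ac)
  qed
  moreover have "Gamma (real d / 2) > 0"
    using assms by (intro Gamma_real_pos) simp
  then have "inverse (Gamma (real d / 2)) \<noteq> 0" "(2::real) powr a \<noteq> 0"
    using less_imp_neq by fastforce+
  ultimately show ?thesis
    by (simp only: landau_theta.cmult landau_theta.cmult_in_iff simp_thms)
qed

text \<open>Comparison with sin^n cos, whose antiderivative is sin^(n+1) / (n+1): on the interval of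
  integration, cos x lies between cos (arcsin r) = sqrt (1 - r^2) and 1.\<close>

lemma integral_sin_power_bounds:
  fixes r :: real
  assumes "0 < r" "r < 1"
  shows "r ^ Suc n / real (Suc n) \<le> integral {0..arcsin r} (\<lambda>x. sin x ^ n)"
    and "sqrt (1 - r\<^sup>2) * integral {0..arcsin r} (\<lambda>x. sin x ^ n) \<le> r ^ Suc n / real (Suc n)"
proof -
  have b: "0 \<le> arcsin r" "arcsin r \<le> pi / 2" "sin (arcsin r) = r"
    using assms arcsin_le_arcsin[of 0 r] arcsin_bounded[of r] by auto
  have I: "((\<lambda>x. sin x ^ n * cos x) has_integral r ^ Suc n / real (Suc n)) {0..arcsin r}"
  proof -
    have "((\<lambda>x. sin x ^ n * cos x) has_integral
        (sin (arcsin r) ^ Suc n / real (Suc n) - sin 0 ^ Suc n / real (Suc n))) {0..arcsin r}"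
      using b(1) by (intro fundamental_theorem_of_calculus)
        (auto intro!: derivative_eq_intros simp del: power_Suc of_nat_Suc
          simp: has_real_derivative_iff_has_vector_derivative[symmetric])
    then show ?thesis by (simp add: b)
  qed
  have J: "(\<lambda>x::real. sin x ^ n) integrable_on {0..arcsin r}"
    by (intro integrable_continuous_real continuous_intros)
  have sin_nonneg: "0 \<le> sin x" if "x \<in> {0..arcsin r}" for x
    using that b by (intro sin_ge_zero) auto
  have cos_ge: "sqrt (1 - r\<^sup>2) \<le> cos x" if "x \<in> {0..arcsin r}" for x
  proof -
    have "cos (arcsin r) \<le> cos x"
      using that b by (intro cos_monotone_0_pi_le) auto
    then show ?thesis
      using assms by (simp add: cos_arcsin)
  qed
  show "r ^ Suc n / real (Suc n) \<le> integral {0..arcsin r} (\<lambda>x. sin x ^ n)"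
    by (rule has_integral_le[OF I integrable_integral[OF J]])
      (use sin_nonneg in \<open>auto intro: mult_left_le\<close>)
  show "sqrt (1 - r\<^sup>2) * integral {0..arcsin r} (\<lambda>x. sin x ^ n) \<le> r ^ Suc n / real (Suc n)"
  proof (rule has_integral_le[OF has_integral_mult_right[OF integrable_integral[OF J]] I])
    fix x assume x: "x \<in> {0..arcsin r}"
    show "sqrt (1 - r\<^sup>2) * sin x ^ n \<le> sin x ^ n * cos x"
      using mult_right_mono[OF cos_ge[OF x] zero_le_power[OF sin_nonneg[OF x]]]
      by (simp add: mult.commute)
  qed
qed

section \<open>Order of growth of \<open>tau\<close>\<close>

text \<open>The bound q < 1 is uniform in D, so the constants can be expressed through q and d
  although r varies with D.\<close>

lemma tau_bigtheta:
  assumes "d \<ge> 1" "q < 1" and r: "eventually (\<lambda>D. 0 < r D \<and> r D \<le> q) sequentially"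
  shows "(\<lambda>D. tau (r D) d D) \<in> \<Theta>(\<lambda>D. real D powr ((real d - 2) / 2) * r D ^ (D - d))"
proof -
  \<comment> \<open>Some r D lies between 0 and q, so q is positive; together with q < 1 this yields
    q^2 < 1.\<close>
  have "q > 0"
    using eventually_happens[OF r] by force
  then have q2: "q\<^sup>2 < 1"
    using assms(2) by (simp add: abs_square_less_1)
  show ?thesis
  proof (cases "d = 1")
    case True
    \<comment> \<open>The factor D - 1 cancels the denominator in the integral bounds, which leaves
      I of order r^(D-1).\<close>
    define I where "I = (\<lambda>D. (real D - 1) * integral {0..arcsin (r D)} (\<lambda>x. sin x ^ (D - 2)))"
    have ev: "eventually (\<lambda>D. 1 * norm (r D ^ (D - 1)) \<le> norm (I D) \<and>
        norm (I D) \<le> inverse (sqrt (1 - q\<^sup>2)) * norm (r D ^ (D - 1))) sequentially"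
      \<comment> \<open>From D = 2 on, the truncated subtraction in the exponent D - 2 is
        exact.\<close>
      using r eventually_ge_at_top[of 2]
    proof eventually_elim
      case (elim D)
      have n: "Suc (D - 2) = D - 1" "real (D - 1) = real D - 1"
        using elim by auto
      have "0 < r D" "r D < 1"
        using elim assms by auto
      note B = integral_sin_power_bounds[OF this, of "D - 2", unfolded n]
      have lo: "r D ^ (D - 1) \<le> I D"
        using B(1) elim by (simp add: I_def field_simps)
      have hi: "sqrt (1 - (r D)\<^sup>2) * I D \<le> r D ^ (D - 1)"
        using B(2) elim by (simp add: I_def field_simps)
      have "0 < r D ^ (D - 1)"
        using elim by simp
      \<comment> \<open>The factor sqrt (1 - r^2) still depends on D; it is replaced by the smaller
        constant sqrt (1 - q^2).\<close>
      have q: "sqrt (1 - q\<^sup>2) \<le> sqrt (1 - (r D)\<^sup>2)" "sqrt (1 - q\<^sup>2) > 0"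
        using elim q2 by (auto intro: power_mono)
      have "sqrt (1 - q\<^sup>2) * I D \<le> r D ^ (D - 1)"
        using mult_right_mono[OF q(1), of "I D"] hi lo \<open>0 < r D ^ (D - 1)\<close> by linarith
      then have "I D \<le> inverse (sqrt (1 - q\<^sup>2)) * r D ^ (D - 1)"
        using q(2) by (simp add: field_simps)
      then show ?case
        using lo \<open>0 < r D ^ (D - 1)\<close> by auto
    qed
    have "I \<in> \<Theta>(\<lambda>D. r D ^ (D - 1))"
      using q2 by (intro bigthetaI'[OF _ _ ev]) auto
    with gamma_binomial_bigtheta[OF assms(1)]
    have "(\<lambda>D. gamma_binomial ((real D - 2) / 2) ((real D - real d) / 2) * I D)
        \<in> \<Theta>(\<lambda>D. real D powr ((real d - 2) / 2) * r D ^ (D - 1))"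
      by (rule landau_theta.mult)
    then show ?thesis
      by (simp add: tau_def I_def True mult_ac)
  next
    case False
    define e where "e = (real d - 2) / 2"
    \<comment> \<open>Here d is at least 2, so the power with exponent e is monotone in its base,
      and 1 - q^2 and 1 bound that base.\<close>
    have "e \<ge> 0"
      using False assms(1) by (simp add: e_def)
    have ev: "eventually (\<lambda>D. (1 - q\<^sup>2) powr e * norm (1::real) \<le> norm ((1 - (r D)\<^sup>2) powr e) \<and>
        norm ((1 - (r D)\<^sup>2) powr e) \<le> 1 * norm (1::real)) sequentially"
      using r
    proof eventually_elim
      case (elim D)
      have q: "0 < 1 - q\<^sup>2" "1 - q\<^sup>2 \<le> 1 - (r D)\<^sup>2"
        using elim q2 by (auto intro: power_mono)
      then have "(1 - q\<^sup>2) powr e \<le> (1 - (r D)\<^sup>2) powr e"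
        using \<open>e \<ge> 0\<close> by (intro powr_mono2) auto
      moreover have "(1 - (r D)\<^sup>2) powr e \<le> 1"
        using powr_mono2[OF \<open>e \<ge> 0\<close>, of "1 - (r D)\<^sup>2" 1] q by simp
      ultimately show ?case
        using q by (simp add: field_simps)
    qed
    have "(\<lambda>D. (1 - (r D)\<^sup>2) powr e) \<in> \<Theta>(\<lambda>_. 1)"
      using q2 by (intro bigthetaI'[OF _ _ ev]) auto
    from landau_theta.mult[OF landau_theta.mult[OF gamma_binomial_bigtheta[OF assms(1)]
        bigtheta_refl[of "\<lambda>D. r D ^ (D - d)"]] this]
    show ?thesis
      using False by (simp add: tau_def e_def)
  qed
qed

text \<open>Both claims of the theorem concern only a real sequence R, either the distances or the
  radii, and are instances of this lemma.\<close>

lemma tau_bigtheta_fixed_or_to_infinity: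
  assumes "d \<ge> 1" "\<epsilon> > 0" "L > 0"
    and gt: "\<forall>D>d. R D > \<epsilon> / L" and R: "fixed_or_to_infinity d R"
  shows "(\<lambda>D. tau (\<epsilon> / (L * R D)) d D)
           \<in> \<Theta>(\<lambda>D. real D powr ((real d - 2) / 2) * (\<epsilon> / (L * R D)) ^ (D - d))"
proof -
  \<comment> \<open>The pointwise bound R D > \<epsilon> / L alone would allow R D to approach
    \<epsilon> / L. A constant K strictly above \<epsilon> / L that eventually bounds R from below
    supplies q = \<epsilon> / (L K) < 1: the fixed value c in the first case, \<epsilon> / L + 1 in
    the second.\<close>
  obtain K where K: "K > \<epsilon> / L" "eventually (\<lambda>D. R D \<ge> K) sequentially"
  proof -
    from R consider c where "\<forall>D>d. R D = c" | "filterlim R at_top sequentially"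
      unfolding fixed_or_to_infinity_def by blast
    then show thesis
    proof cases
      case 1
      show thesis
      proof (rule that)
        show "c > \<epsilon> / L"
          using 1 gt by (metis lessI)
        show "eventually (\<lambda>D. R D \<ge> c) sequentially"
          using eventually_gt_at_top[of d] by eventually_elim (use 1 in simp)
      qed
    next
      case 2
      then show thesis
        using that[of "\<epsilon> / L + 1"] by (simp add: filterlim_at_top)
    qed
  qed
  have "0 < \<epsilon> / L"
    using assms by simp
  with K(1) have "K > 0"
    by linarith
  show ?thesis
  proof (rule tau_bigtheta[OF assms(1)])
    show "\<epsilon> / (L * K) < 1"
      using K(1) \<open>K > 0\<close> assms by (simp add: field_simps)
    show "eventually (\<lambda>D. 0 < \<epsilon> / (L * R D) \<and> \<epsilon> / (L * R D) \<le> \<epsilon> / (L * K)) sequentially"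
      using K(2) by eventually_elim (use \<open>K > 0\<close> assms in \<open>auto intro!: divide_left_mono\<close>)
  qed
qed

theorem corollary4p7:
  fixes d :: nat and \<epsilon> L :: real
  assumes "d \<ge> 1" and "\<epsilon> > 0" and "L > 0"
  shows
    "(\<forall>(x :: nat \<Rightarrow> nat \<Rightarrow> real) (p :: nat \<Rightarrow> nat \<Rightarrow> real).
        (\<forall>D>d. euclid_dist D (x D) (p D) > \<epsilon> / L) \<longrightarrow>
        fixed_or_to_infinity d (\<lambda>D. euclid_dist D (x D) (p D)) \<longrightarrow>
        (\<lambda>D. tau (\<epsilon> / (L * euclid_dist D (x D) (p D))) d D)
          \<in> \<Theta>(\<lambda>D. real D powr ((real d - 2) / 2)
                  * (\<epsilon> / (L * euclid_dist D (x D) (p D))) ^ (D - d)))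
     \<and>
     (\<forall>Rmax :: nat \<Rightarrow> real.
        (\<forall>D>d. Rmax D > \<epsilon> / L) \<longrightarrow>
        fixed_or_to_infinity d Rmax \<longrightarrow>
        (\<lambda>D. tau (\<epsilon> / (L * Rmax D)) d D)
          \<in> \<Theta>(\<lambda>D. real D powr ((real d - 2) / 2)
                  * (\<epsilon> / (L * Rmax D)) ^ (D - d)))"
  by (intro conjI allI impI; rule tau_bigtheta_fixed_or_to_infinity[OF assms]; assumption)

end
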